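(* Let $\phi$ and $\psi$ be any positive modal formulas. Then $\phi\supset\psi\in\mathsf{GL}$ if and only if the sequent $\phi\vdash\psi$ is provable in $\mathsf{GL}_{+}^{\top\bot}$.
   Context: $\mathsf{GL}$ is the least normal modal logic (set of propositional modal formulas, with classical connectives, implication written $\supset$, and $\Diamond$ the dual $\neg\Box\neg$ of $\Box$; containing $\mathsf{K}$, i.e. all classical tautologies and $\Box(p\supset q)\supset(\Box p\supset\Box q)$, and closed under modus ponens, uniform substitution and necessitation) that contains the Löb formula $\Box(\Box p\supset p)\supset\Box p$. Positive modal formulas are the modal formulas built from a countable set $\mathsf{Prop}$ of propositional variables and the constants $\bot,\top$ using binary $\lor,\land$ and unary $\Diamond,\Box$ (no negation, no implication); $\Phi$ is the set of all of them. $\Box^0\phi=\phi$, $\Box^{n+1}\phi=\Box(\Box^n\phi)$, and similarly for $\Diamond^n$. A sequent is an expression $\phi\vdash\psi$ with $\phi,\psi\in\Phi$. The proof system $\mathsf{GL}_{+}^{\top\bot}$ derives sequents (derivations may be infinite, well-founded trees because of the last two rules) from the following axioms and rules, for all $\phi,\psi,\chi\in\Phi$. Axioms: $\phi\vdash\phi$; $\phi\vdash\phi\lor\psi$; $\psi\vdash\phi\lor\psi$; $\phi\land\psi\vdash\phi$; $\phi\land\psi\vdash\psi$; $\phi\land(\psi\lor\chi)\vdash(\phi\land\psi)\lor(\phi\land\chi)$; $\Diamond(\phi\lor\psi)\vdash\Diamond\phi\lor\Diamond\psi$; $\Box\phi\land\Box\psi\vdash\Box(\phi\land\psi)$; $\Diamond\phi\land\Box\psi\vdash\Diamond(\phi\land\psi)$;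 $\Box(\phi\lor\psi)\vdash\Box\phi\lor\Diamond\psi$; $\bot\vdash\phi$; $\phi\vdash\top$; $\Diamond\bot\vdash\bot$; $\top\vdash\Box\top$; $\Diamond\Diamond\phi\vdash\Diamond\phi$; $\Box\phi\vdash\Box\Box\phi$. Rules: from $\phi\vdash\psi$ and $\psi\vdash\chi$ infer $\phi\vdash\chi$; from $\phi\vdash\chi$ and $\psi\vdash\chi$ infer $\phi\lor\psi\vdash\chi$; from $\chi\vdash\phi$ and $\chi\vdash\psi$ infer $\chi\vdash\phi\land\psi$; from $\phi\vdash\psi$ infer $\Diamond\phi\vdash\Diamond\psi$; from $\phi\vdash\psi$ infer $\Box\phi\vdash\Box\psi$; GLD-rules: from the premises $\psi\land\Box^n\bot\vdash\phi$ for all $n\in\omega$ infer $\psi\vdash\phi$; from the premises $\phi\vdash\psi\lor\Diamond^n\top$ for all $n\in\omega$ infer $\phi\vdash\psi$. *)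

theory Defs
  imports Main
begin

datatype fm =
    Var nat
  | Bot
  | Top
  | Neg fm
  | And fm fm
  | Or fm fm
  | Imp fm fm
  | Box fm

definition Dia :: "fm \<Rightarrow> fm" where
  "Dia \<phi> = Neg (Box (Neg \<phi>))"

primrec subst :: "(nat \<Rightarrow> fm) \<Rightarrow> fm \<Rightarrow> fm" where
  "subst \<sigma> (Var x) = \<sigma> x"
| "subst \<sigma> Bot = Bot"
| "subst \<sigma> Top = Top"
| "subst \<sigma> (Neg \<phi>) = Neg (subst \<sigma> \<phi>)"
| "subst \<sigma> (And \<phi> \<psi>) = And (subst \<sigma> \<phi>) (subst \<sigma> \<psi>)"
| "subst \<sigma> (Or \<phi> \<psi>) = Or (subst \<sigma> \<phi>) (subst \<sigma> \<psi>)"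
| "subst \<sigma> (Imp \<phi> \<psi>) = Imp (subst \<sigma> \<phi>) (subst \<sigma> \<psi>)"
| "subst \<sigma> (Box \<phi>) = Box (subst \<sigma> \<phi>)"

text \<open>Classical truth-functional evaluation: \<open>v\<close> assigns truth values to the variables, and \<open>b\<close>
  assigns arbitrary truth values to the formulas \<open>Box \<phi>\<close> (indexed by \<open>\<phi>\<close>), which are thus
  treated as additional propositional atoms.\<close>

primrec truth :: "(nat \<Rightarrow> bool) \<Rightarrow> (fm \<Rightarrow> bool) \<Rightarrow> fm \<Rightarrow> bool" where
  "truth v b (Var x) \<longleftrightarrow> v x"
| "truth v b Bot \<longleftrightarrow> False"
| "truth v b Top \<longleftrightarrow> True"
| "truth v b (Neg \<phi>) \<longleftrightarrow> \<not> truth v b \<phi>"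
| "truth v b (And \<phi> \<psi>) \<longleftrightarrow> truth v b \<phi> \<and> truth v b \<psi>"
| "truth v b (Or \<phi> \<psi>) \<longleftrightarrow> truth v b \<phi> \<or> truth v b \<psi>"
| "truth v b (Imp \<phi> \<psi>) \<longleftrightarrow> (truth v b \<phi> \<longrightarrow> truth v b \<psi>)"
| "truth v b (Box \<phi>) \<longleftrightarrow> b \<phi>"

definition tautology :: "fm \<Rightarrow> bool" where
  "tautology \<phi> \<longleftrightarrow> (\<forall>v b. truth v b \<phi>)"

definition normal_modal_logic :: "fm set \<Rightarrow> bool" where
  "normal_modal_logic L \<longleftrightarrow>
     (\<forall>\<phi>. tautology \<phi> \<longrightarrow> \<phi> \<in> L) \<and>
     Imp (Box (Imp (Var 0) (Var 1))) (Imp (Box (Var 0)) (Box (Var 1))) \<in> L \<and>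
     (\<forall>\<phi> \<psi>. \<phi> \<in> L \<longrightarrow> Imp \<phi> \<psi> \<in> L \<longrightarrow> \<psi> \<in> L) \<and>
     (\<forall>\<phi> \<sigma>. \<phi> \<in> L \<longrightarrow> subst \<sigma> \<phi> \<in> L) \<and>
     (\<forall>\<phi>. \<phi> \<in> L \<longrightarrow> Box \<phi> \<in> L)"

definition Loeb :: fm where
  "Loeb = Imp (Box (Imp (Box (Var 0)) (Var 0))) (Box (Var 0))"

definition GL :: "fm set" where
  "GL = \<Inter>{L. normal_modal_logic L \<and> Loeb \<in> L}"


datatype pfm =
    PVar nat
  | PBot
  | PTop
  | POr pfm pfm
  | PAnd pfm pfm
  | PDia pfm
  | PBox pfm

primrec fm_of :: "pfm \<Rightarrow> fm" where
  "fm_of (PVar x) = Var x"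
| "fm_of PBot = Bot"
| "fm_of PTop = Top"
| "fm_of (POr \<phi> \<psi>) = Or (fm_of \<phi>) (fm_of \<psi>)"
| "fm_of (PAnd \<phi> \<psi>) = And (fm_of \<phi>) (fm_of \<psi>)"
| "fm_of (PDia \<phi>) = Dia (fm_of \<phi>)"
| "fm_of (PBox \<phi>) = Box (fm_of \<phi>)"

inductive derivable :: "pfm \<Rightarrow> pfm \<Rightarrow> bool"  (infix \<open>\<turnstile>\<close> 50) where
  ax_refl: "\<phi> \<turnstile> \<phi>"
| ax_or1: "\<phi> \<turnstile> POr \<phi> \<psi>"
| ax_or2: "\<psi> \<turnstile> POr \<phi> \<psi>"
| ax_and1: "PAnd \<phi> \<psi> \<turnstile> \<phi>"
| ax_and2: "PAnd \<phi> \<psi> \<turnstile> \<psi>"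
| ax_distrib: "PAnd \<phi> (POr \<psi> \<chi>) \<turnstile> POr (PAnd \<phi> \<psi>) (PAnd \<phi> \<chi>)"
| ax_Dia_or: "PDia (POr \<phi> \<psi>) \<turnstile> POr (PDia \<phi>) (PDia \<psi>)"
| ax_Box_and: "PAnd (PBox \<phi>) (PBox \<psi>) \<turnstile> PBox (PAnd \<phi> \<psi>)"
| ax_Dia_Box_and: "PAnd (PDia \<phi>) (PBox \<psi>) \<turnstile> PDia (PAnd \<phi> \<psi>)"
| ax_Box_or: "PBox (POr \<phi> \<psi>) \<turnstile> POr (PBox \<phi>) (PDia \<psi>)"
| ax_bot: "PBot \<turnstile> \<phi>"
| ax_top: "\<phi> \<turnstile> PTop"
| ax_Dia_bot: "PDia PBot \<turnstile> PBot"
| ax_Box_top: "PTop \<turnstile> PBox PTop"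
| ax_Dia_trans: "PDia (PDia \<phi>) \<turnstile> PDia \<phi>"
| ax_Box_trans: "PBox \<phi> \<turnstile> PBox (PBox \<phi>)"
| cut: "\<phi> \<turnstile> \<psi> \<Longrightarrow> \<psi> \<turnstile> \<chi> \<Longrightarrow> \<phi> \<turnstile> \<chi>"
| or_left: "\<phi> \<turnstile> \<chi> \<Longrightarrow> \<psi> \<turnstile> \<chi> \<Longrightarrow> POr \<phi> \<psi> \<turnstile> \<chi>"
| and_right: "\<chi> \<turnstile> \<phi> \<Longrightarrow> \<chi> \<turnstile> \<psi> \<Longrightarrow> \<chi> \<turnstile> PAnd \<phi> \<psi>"
| Dia_mono: "\<phi> \<turnstile> \<psi> \<Longrightarrow> PDia \<phi> \<turnstile> PDia \<psi>"
| Box_mono: "\<phi> \<turnstile> \<psi> \<Longrightarrow> PBox \<phi> \<turnstile> PBox \<psi>"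
| GLD_Box: "(\<And>n. PAnd \<psi> ((PBox ^^ n) PBot) \<turnstile> \<phi>) \<Longrightarrow> \<psi> \<turnstile> \<phi>"
| GLD_Dia: "(\<And>n. \<phi> \<turnstile> POr \<psi> ((PDia ^^ n) PTop)) \<Longrightarrow> \<phi> \<turnstile> \<psi>"

end

theory Submission
  imports Defs
begin

text \<open>
  Both directions pass through Kripke semantics: the class of transitive models in which every world
  \<open>w\<close> has a natural number \<open>r w\<close> as rank, and ranks strictly decrease along the accessibility
  relation. Such models validate the Loeb formula, and they validate the two infinitary rules because
  a world of rank \<open>r\<close> satisfies \<open>\<box>\<^sup>n\<bottom>\<close> and refutes \<open>\<diamond>\<^sup>n\<top>\<close> for every \<open>n > r\<close>.
  So \<open>GL\<close> and \<open>\<turnstile>\<close> are both sound (\<open>GL_sound\<close>, \<open>derivable_sound\<close>), and the theorem follows once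
  both are complete for the same class.

  In each case a counter-model is built whose worlds are prime filters of the logic, ordered by
  provable implication; \<open>prime_filter_separation\<close> supplies the worlds. What differs is how the
  canonical accessibility relation is made to respect ranks.

  For \<open>GL\<close> (\<open>GL_complete\<close>) only the finitely many boxed subformulas of the refuted formula matter:
  a step must make at least one of them newly true, and the rank of a world counts those that still
  fail. The Loeb formula is what produces such steps.

  For \<open>\<turnstile>\<close> (\<open>derivable_complete\<close>) the rule \<open>GLD_Box\<close> reduces \<open>\<phi> \<turnstile> \<psi>\<close> to the sequents
  \<open>\<phi> \<and> \<box>\<^sup>n\<bottom> \<turnstile> \<psi>\<close>. If one of these is underivable, then some prime filter contains \<open>\<phi>\<close> and
  \<open>\<box>\<^sup>n\<bottom>\<close> but not \<open>\<psi>\<close>. Going up from a prime filter that contains \<open>\<box>\<^sup>n\<bottom>\<close>, a chain of canonical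
  steps has length less than \<open>n\<close>, so the least such \<open>n\<close> is a rank. The infinitary
  rule is thus applied only once, outside the canonical model, which is why ordinary prime filters
  suffice as worlds.
\<close>

section \<open>Prime filters of distributive prelattices\<close>

text \<open>The order is only a preorder, so that provable implication between formulas is an instance
  without passing to equivalence classes.\<close>

locale distributive_prelattice =
  fixes le :: "'a \<Rightarrow> 'a \<Rightarrow> bool"
    and conj disj :: "'a \<Rightarrow> 'a \<Rightarrow> 'a"
    and top bot :: 'a
  assumes refl: "le a a"
    and trans: "le a b \<Longrightarrow> le b c \<Longrightarrow> le a c"
    and conj1: "le (conj a b) a"
    and conj2: "le (conj a b) b"
    and conjI: "le c a \<Longrightarrow> le c b \<Longrightarrow> le c (conj a b)"
    and disj1: "le a (disj a b)"
    and disj2: "le b (disj a b)"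
    and disjE: "le a c \<Longrightarrow> le b c \<Longrightarrow> le (disj a b) c"
    and distrib: "le (conj a (disj b c)) (disj (conj a b) (conj a c))"
    and top: "le a top"
    and bot: "le bot a"
begin

definition filter :: "'a set \<Rightarrow> bool" where
  "filter F \<longleftrightarrow> top \<in> F \<and> (\<forall>a b. a \<in> F \<longrightarrow> le a b \<longrightarrow> b \<in> F) \<and>
     (\<forall>a b. a \<in> F \<longrightarrow> b \<in> F \<longrightarrow> conj a b \<in> F)"

definition ideal :: "'a set \<Rightarrow> bool" where
  "ideal I \<longleftrightarrow> bot \<in> I \<and> (\<forall>a b. b \<in> I \<longrightarrow> le a b \<longrightarrow> a \<in> I) \<and>
     (\<forall>a b. a \<in> I \<longrightarrow> b \<in> I \<longrightarrow> disj a b \<in> I)"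

definition prime_filter :: "'a set \<Rightarrow> bool" where
  "prime_filter F \<longleftrightarrow> filter F \<and> bot \<notin> F \<and> (\<forall>a b. disj a b \<in> F \<longrightarrow> a \<in> F \<or> b \<in> F)"

lemma filter_up: "filter F \<Longrightarrow> a \<in> F \<Longrightarrow> le a b \<Longrightarrow> b \<in> F"
  by (auto simp: filter_def)

lemma filter_top: "filter F \<Longrightarrow> top \<in> F"
  by (auto simp: filter_def)

lemma filter_conj: "filter F \<Longrightarrow> a \<in> F \<Longrightarrow> b \<in> F \<Longrightarrow> conj a b \<in> F"
  by (auto simp: filter_def)

lemma prime_up: "prime_filter F \<Longrightarrow> a \<in> F \<Longrightarrow> le a b \<Longrightarrow> b \<in> F"
  by (auto simp: prime_filter_def filter_def)

lemma prime_top: "prime_filter F \<Longrightarrow> top \<in> F"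
  by (auto simp: prime_filter_def filter_def)

lemma prime_bot: "prime_filter F \<Longrightarrow> bot \<notin> F"
  by (auto simp: prime_filter_def)

lemma prime_conj_iff: "prime_filter F \<Longrightarrow> conj a b \<in> F \<longleftrightarrow> a \<in> F \<and> b \<in> F"
  unfolding prime_filter_def filter_def using conj1 conj2 by blast

lemma prime_disj_iff: "prime_filter F \<Longrightarrow> disj a b \<in> F \<longleftrightarrow> a \<in> F \<or> b \<in> F"
  unfolding prime_filter_def filter_def using disj1 disj2 by blast

lemma principal_ideal: "ideal {a. le a b}"
  unfolding ideal_def by (auto intro: bot disjE elim: trans)

lemma principal_filter: "filter {b. le a b}"
  unfolding filter_def by (auto intro: top conjI elim: trans)

lemma conj_mono: "le a c \<Longrightarrow> le b d \<Longrightarrow> le (conj a b) (conj c d)"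
  by (intro conjI) (erule trans[OF conj1], erule trans[OF conj2])

lemma disj_mono: "le a c \<Longrightarrow> le b d \<Longrightarrow> le (disj a b) (disj c d)"
  by (intro disjE) (erule trans[OF _ disj1], erule trans[OF _ disj2])

lemma filter_extend:
  assumes "filter F"
  shows "filter {c. \<exists>m\<in>F. le (conj m a) c}"
  unfolding filter_def
proof (intro HOL.conjI allI impI)
  show "top \<in> {c. \<exists>m\<in>F. le (conj m a) c}"
    using assms top unfolding filter_def by blast
next
  fix b c assume "b \<in> {c. \<exists>m\<in>F. le (conj m a) c}" "le b c"
  then show "c \<in> {c. \<exists>m\<in>F. le (conj m a) c}" by (auto elim: trans)
next
  fix b c assume "b \<in> {c. \<exists>m\<in>F. le (conj m a) c}" "c \<in> {c. \<exists>m\<in>F. le (conj m a) c}"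
  then obtain m n where mn: "m \<in> F" "le (conj m a) b" "n \<in> F" "le (conj n a) c" by blast
  have "conj m n \<in> F" using assms mn unfolding filter_def by blast
  moreover have "le (conj (conj m n) a) (conj b c)"
    by (intro conjI trans[OF _ mn(2)] trans[OF _ mn(4)] conj_mono conj1 conj2 refl)
  ultimately show "conj b c \<in> {c. \<exists>m\<in>F. le (conj m a) c}" by blast
qed

text \<open>By Zorn's lemma there is a filter \<open>M \<supseteq> F\<close> that is maximal among those avoiding \<open>I\<close>, and it is
  prime: if \<open>a \<or> b \<in> M\<close> with both \<open>a\<close> and \<open>b\<close> outside \<open>M\<close>, then by maximality some \<open>k \<in> M\<close> has
  \<open>k \<and> a\<close> and \<open>k \<and> b\<close> below elements of \<open>I\<close>, so by distributivity \<open>k \<and> (a \<or> b)\<close>, a member of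
  \<open>M\<close>, is below an element of \<open>I\<close> as well.\<close>

theorem prime_filter_separation:
  assumes F: "filter F" and I: "ideal I" and disjoint: "F \<inter> I = {}"
  obtains P where "prime_filter P" "F \<subseteq> P" "P \<inter> I = {}"
proof -
  let ?A = "{G. filter G \<and> F \<subseteq> G \<and> G \<inter> I = {}}"
  have "\<exists>M\<in>?A. \<forall>X\<in>?A. M \<subseteq> X \<longrightarrow> X = M"
  proof (rule subset_Zorn_nonempty)
    show "?A \<noteq> {}" using assms by auto
  next
    fix C assume ne: "C \<noteq> {}" and C: "subset.chain ?A C"
    then have sub: "\<And>G. G \<in> C \<Longrightarrow> filter G \<and> F \<subseteq> G \<and> G \<inter> I = {}"
      and lin: "\<And>G H. G \<in> C \<Longrightarrow> H \<in> C \<Longrightarrow> G \<subseteq> H \<or> H \<subseteq> G"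
      by (auto simp: subset_chain_def)
    have "filter (\<Union>C)"
      unfolding filter_def
    proof (intro HOL.conjI allI impI)
      show "top \<in> \<Union>C" using ne sub filter_top by blast
    next
      fix a b assume "a \<in> \<Union>C" "le a b"
      then show "b \<in> \<Union>C" using sub filter_up by blast
    next
      fix a b assume "a \<in> \<Union>C" "b \<in> \<Union>C"
      then obtain G H where "G \<in> C" "a \<in> G" "H \<in> C" "b \<in> H" by blast
      then obtain K where "K \<in> C" "a \<in> K" "b \<in> K" using lin[of G H] by blast
      then show "conj a b \<in> \<Union>C" using sub filter_conj by blast
    qed
    moreover obtain G where "G \<in> C" using ne by blast
    ultimately show "\<Union>C \<in> ?A" using sub by auto
  qed
  then obtain M where M: "filter M" "F \<subseteq> M" "M \<inter> I = {}"
    and max: "\<And>X. filter X \<Longrightarrow> F \<subseteq> X \<Longrightarrow> X \<inter> I = {} \<Longrightarrow> M \<subseteq> X \<Longrightarrow> X = M"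
    by auto
  have meets: "\<exists>m\<in>M. \<exists>i\<in>I. le (conj m a) i" if "a \<notin> M" for a
  proof (rule ccontr)
    let ?X = "{c. \<exists>m\<in>M. le (conj m a) c}"
    assume "\<not> ?thesis"
    then have "?X \<inter> I = {}" by blast
    moreover have "M \<subseteq> ?X" using conj1 by blast
    ultimately have "?X = M" using M(2) by (intro max[OF filter_extend[OF M(1)]]) auto
    moreover have "a \<in> ?X" using filter_top[OF M(1)] conj2 by blast
    ultimately show False using that by blast
  qed
  have "a \<in> M \<or> b \<in> M" if ab: "disj a b \<in> M" for a b
  proof (rule ccontr)
    assume "\<not> ?thesis"
    then obtain m n i j where *: "m \<in> M" "i \<in> I" "le (conj m a) i" "n \<in> M" "j \<in> I" "le (conj n b) j"
      using meets by blast
    let ?k = "conj m n"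
    have "conj ?k (disj a b) \<in> M" using filter_conj[OF M(1)] ab * by blast
    moreover have "le (conj ?k a) i" "le (conj ?k b) j"
      by (rule trans[OF conj_mono[OF conj1 refl] *(3)], rule trans[OF conj_mono[OF conj2 refl] *(6)])
    then have "le (disj (conj ?k a) (conj ?k b)) (disj i j)"
      by (rule disj_mono)
    ultimately have "disj i j \<in> M" using filter_up[OF M(1)] trans[OF distrib] by blast
    moreover have "disj i j \<in> I" using I * unfolding ideal_def by blast
    ultimately show False using M(3) by blast
  qed
  moreover have "bot \<notin> M" using I M(3) unfolding ideal_def by blast
  ultimately have "prime_filter M" using M(1) unfolding prime_filter_def by simp
  then show thesis using M(2,3) by (rule that)
qed

end

section \<open>Ranked transitive models and soundness\<close>

primrec eval :: "('w \<Rightarrow> 'w \<Rightarrow> bool) \<Rightarrow> ('w \<Rightarrow> nat \<Rightarrow> bool) \<Rightarrow> 'w \<Rightarrow> fm \<Rightarrow> bool" where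
  "eval R V w (Var x) \<longleftrightarrow> V w x"
| "eval R V w Bot \<longleftrightarrow> False"
| "eval R V w Top \<longleftrightarrow> True"
| "eval R V w (Neg \<phi>) \<longleftrightarrow> \<not> eval R V w \<phi>"
| "eval R V w (And \<phi> \<psi>) \<longleftrightarrow> eval R V w \<phi> \<and> eval R V w \<psi>"
| "eval R V w (Or \<phi> \<psi>) \<longleftrightarrow> eval R V w \<phi> \<or> eval R V w \<psi>"
| "eval R V w (Imp \<phi> \<psi>) \<longleftrightarrow> (eval R V w \<phi> \<longrightarrow> eval R V w \<psi>)"
| "eval R V w (Box \<phi>) \<longleftrightarrow> (\<forall>u. R w u \<longrightarrow> eval R V u \<phi>)"

lemma eval_Dia [simp]: "eval R V w (Dia \<phi>) \<longleftrightarrow> (\<exists>u. R w u \<and> eval R V u \<phi>)"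
  by (simp add: Dia_def)

lemma eval_subst: "eval R V w (subst \<sigma> \<phi>) \<longleftrightarrow> eval R (\<lambda>u x. eval R V u (\<sigma> x)) w \<phi>"
  by (induction \<phi> arbitrary: w) auto

text \<open>Tautologies are valid because a world is a truth-functional valuation of variables and boxed
  formulas.\<close>

lemma eval_truth: "eval R V w \<phi> \<longleftrightarrow> truth (V w) (\<lambda>\<psi>. eval R V w (Box \<psi>)) \<phi>"
  by (induction \<phi>) auto

locale ranked_frame =
  fixes R :: "'w \<Rightarrow> 'w \<Rightarrow> bool" and r :: "'w \<Rightarrow> nat"
  assumes R_trans: "R u v \<Longrightarrow> R v w \<Longrightarrow> R u w"
    and rank: "R u v \<Longrightarrow> r v < r u"
begin

lemma eval_Loeb: "eval R V w Loeb"
proof -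
  have "eval R V u (Var 0)"
    if loeb: "eval R V w (Box (Imp (Box (Var 0)) (Var 0)))" and "R w u" for u
    using \<open>R w u\<close>
  proof (induction "r u" arbitrary: u rule: less_induct)
    case less
    have "eval R V v (Var 0)" if "R u v" for v
      using less.hyps[OF rank[OF that]] R_trans[OF less.prems that] by blast
    then show ?case using loeb less.prems by simp
  qed
  then show ?thesis by (simp add: Loeb_def)
qed

text \<open>The formulas valid under all valuations of one fixed frame form a normal modal logic.
  Quantifying over the valuations is what gives closure under substitution.\<close>

theorem GL_sound:
  assumes "\<phi> \<in> GL"
  shows "eval R V w \<phi>"
proof -
  let ?L = "{\<phi>. \<forall>V w. eval R V w \<phi>}"
  have "eval R V w \<chi>" if "tautology \<chi>" for \<chi> V w
    using that eval_truth[of R V w \<chi>] unfolding tautology_def by blast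
  then have "normal_modal_logic ?L"
    unfolding normal_modal_logic_def by (simp add: eval_subst)
  moreover have "Loeb \<in> ?L" by (simp add: eval_Loeb)
  ultimately show ?thesis using assms unfolding GL_def by blast
qed

lemma Box_iterate_Bot: "r w < n \<Longrightarrow> eval R V w (fm_of ((PBox ^^ n) PBot))"
proof (induction n arbitrary: w)
  case (Suc n)
  have "r u < n" if "R w u" for u using rank[OF that] Suc.prems by simp
  then show ?case using Suc.IH by simp
qed simp

lemma Dia_iterate_Top: "eval R V w (fm_of ((PDia ^^ n) PTop)) \<Longrightarrow> n \<le> r w"
proof (induction n arbitrary: w)
  case (Suc n)
  then show ?case using rank by (fastforce simp: Suc_le_eq intro: le_less_trans)
qed simp

theorem derivable_sound: "\<phi> \<turnstile> \<psi> \<Longrightarrow> eval R V w (fm_of \<phi>) \<Longrightarrow> eval R V w (fm_of \<psi>)"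
proof (induction arbitrary: w rule: derivable.induct)
  case (GLD_Box \<psi> \<phi>)
  then show ?case using Box_iterate_Bot[of w "Suc (r w)" V] by (auto simp del: funpow.simps)
next
  case (GLD_Dia \<phi> \<psi>)
  then show ?case using Dia_iterate_Top[of V w "Suc (r w)"] by (auto simp del: funpow.simps)
qed (auto intro: R_trans)

end

section \<open>Kripke completeness of GL\<close>

lemma GL_iff: "\<phi> \<in> GL \<longleftrightarrow> (\<forall>L. normal_modal_logic L \<longrightarrow> Loeb \<in> L \<longrightarrow> \<phi> \<in> L)"
  unfolding GL_def by auto

lemma GL_Loeb: "Loeb \<in> GL"
  by (simp add: GL_iff)

lemma GL_taut: "(\<And>v b. truth v b \<phi>) \<Longrightarrow> \<phi> \<in> GL"
  by (simp add: GL_iff normal_modal_logic_def tautology_def)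

lemma GL_mp: "Imp \<phi> \<psi> \<in> GL \<Longrightarrow> \<phi> \<in> GL \<Longrightarrow> \<psi> \<in> GL"
  unfolding GL_iff normal_modal_logic_def by blast

lemma GL_nec: "\<phi> \<in> GL \<Longrightarrow> Box \<phi> \<in> GL"
  unfolding GL_iff normal_modal_logic_def by blast

lemma GL_subst: "\<phi> \<in> GL \<Longrightarrow> subst \<sigma> \<phi> \<in> GL"
  unfolding GL_iff normal_modal_logic_def by blast

lemma GL_taut_mp:
  assumes "\<phi> \<in> GL" and "\<And>v b. truth v b \<phi> \<Longrightarrow> truth v b \<psi>"
  shows "\<psi> \<in> GL"
  by (rule GL_mp[OF GL_taut assms(1)]) (simp add: assms(2))

lemma GL_taut_mp2:
  assumes "\<phi> \<in> GL" "\<chi> \<in> GL" and "\<And>v b. truth v b \<phi> \<Longrightarrow> truth v b \<chi> \<Longrightarrow> truth v b \<psi>"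
  shows "\<psi> \<in> GL"
  by (rule GL_mp[OF GL_mp[OF GL_taut assms(1)] assms(2)]) (simp add: assms(3))

lemma GL_K: "Imp (Box (Imp \<phi> \<psi>)) (Imp (Box \<phi>) (Box \<psi>)) \<in> GL"
proof -
  have "Imp (Box (Imp (Var 0) (Var 1))) (Imp (Box (Var 0)) (Box (Var 1))) \<in> GL"
    by (simp add: GL_iff normal_modal_logic_def)
  from GL_subst[OF this, of "\<lambda>x. if x = 0 then \<phi> else \<psi>"] show ?thesis by simp
qed

lemma GL_Loeb_inst: "Imp (Box (Imp (Box \<phi>) \<phi>)) (Box \<phi>) \<in> GL"
  using GL_subst[OF GL_Loeb, of "\<lambda>_. \<phi>"] by (simp add: Loeb_def)

lemma GL_trans: "Imp \<phi> \<psi> \<in> GL \<Longrightarrow> Imp \<psi> \<chi> \<in> GL \<Longrightarrow> Imp \<phi> \<chi> \<in> GL"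
  by (erule (1) GL_taut_mp2) auto

lemma GL_Box_mono: "Imp \<phi> \<psi> \<in> GL \<Longrightarrow> Imp (Box \<phi>) (Box \<psi>) \<in> GL"
  using GL_mp[OF GL_K GL_nec] .

lemma GL_Box_And: "Imp (And (Box \<phi>) (Box \<psi>)) (Box (And \<phi> \<psi>)) \<in> GL"
proof -
  have "Imp (Box \<phi>) (Box (Imp \<psi> (And \<phi> \<psi>))) \<in> GL"
    by (intro GL_Box_mono GL_taut) auto
  from this GL_K[of \<psi> "And \<phi> \<psi>"] show ?thesis by (rule GL_taut_mp2) auto
qed

text \<open>Transitivity follows from the Loeb formula for \<open>\<phi> \<and> \<box>\<phi>\<close>: since \<open>\<box>(\<phi> \<and> \<box>\<phi>)\<close> implies
  \<open>\<box>\<phi>\<close>, the formula \<open>\<phi>\<close> implies \<open>\<box>(\<phi> \<and> \<box>\<phi>) \<supset> \<phi> \<and> \<box>\<phi>\<close>.\<close>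

lemma GL_4: "Imp (Box \<phi>) (Box (And \<phi> (Box \<phi>))) \<in> GL"
proof -
  let ?X = "And \<phi> (Box \<phi>)"
  have "Imp (Box ?X) (Box \<phi>) \<in> GL" by (intro GL_Box_mono GL_taut) auto
  then have "Imp \<phi> (Imp (Box ?X) ?X) \<in> GL" by (rule GL_taut_mp) auto
  from GL_trans[OF GL_Box_mono[OF this] GL_Loeb_inst] show ?thesis .
qed

interpretation GL: distributive_prelattice "\<lambda>\<phi> \<psi>. Imp \<phi> \<psi> \<in> GL" And Or Top Bot
proof
  show "Imp c (And a b) \<in> GL" if "Imp c a \<in> GL" "Imp c b \<in> GL" for a b c
    using that by (rule GL_taut_mp2) auto
  show "Imp (Or a b) c \<in> GL" if "Imp a c \<in> GL" "Imp b c \<in> GL" for a b c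
    using that by (rule GL_taut_mp2) auto
qed (auto intro: GL_taut GL_trans)

lemma GL_prime_Neg: "GL.prime_filter x \<Longrightarrow> Neg \<phi> \<in> x \<longleftrightarrow> \<phi> \<notin> x"
proof -
  assume x: "GL.prime_filter x"
  have "Imp Top (Or \<phi> (Neg \<phi>)) \<in> GL" "Imp (And \<phi> (Neg \<phi>)) Bot \<in> GL"
    by (auto intro: GL_taut)
  then have "Or \<phi> (Neg \<phi>) \<in> x" "And \<phi> (Neg \<phi>) \<notin> x"
    using GL.prime_up[OF x] GL.prime_top[OF x] GL.prime_bot[OF x] by blast+
  then show ?thesis using GL.prime_disj_iff[OF x] GL.prime_conj_iff[OF x] by blast
qed

lemma GL_prime_Imp: "GL.prime_filter x \<Longrightarrow> Imp \<phi> \<psi> \<in> x \<longleftrightarrow> (\<phi> \<in> x \<longrightarrow> \<psi> \<in> x)"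
proof -
  assume x: "GL.prime_filter x"
  have "Imp (Imp \<phi> \<psi>) (Or (Neg \<phi>) \<psi>) \<in> GL" "Imp (Or (Neg \<phi>) \<psi>) (Imp \<phi> \<psi>) \<in> GL"
    by (auto intro: GL_taut)
  then have "Imp \<phi> \<psi> \<in> x \<longleftrightarrow> Or (Neg \<phi>) \<psi> \<in> x"
    using GL.prime_up[OF x] by blast
  then show ?thesis using GL.prime_disj_iff[OF x] GL_prime_Neg[OF x] by blast
qed

text \<open>If \<open>\<box>\<psi>\<close> fails at \<open>x\<close>, there is a successor that refutes \<open>\<psi>\<close> although it satisfies \<open>\<box>\<psi>\<close>:
  otherwise some \<open>\<box>\<beta> \<in> x\<close> yields \<open>\<beta> \<and> \<box>\<beta> \<supset> (\<box>\<psi> \<supset> \<psi>)\<close>, hence \<open>\<box>\<beta> \<supset> \<box>(\<box>\<psi> \<supset> \<psi>)\<close>,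
  and the Loeb formula puts \<open>\<box>\<psi>\<close> into \<open>x\<close>.\<close>

lemma GL_successor:
  assumes x: "GL.prime_filter x" and psi: "Box \<psi> \<notin> x"
  obtains y where "GL.prime_filter y" "\<forall>\<chi>. Box \<chi> \<in> x \<longrightarrow> \<chi> \<in> y \<and> Box \<chi> \<in> y" "Box \<psi> \<in> y" "\<psi> \<notin> y"
proof -
  let ?C = "{\<beta>. \<exists>\<gamma>. Box \<gamma> \<in> x \<and> Imp (And \<gamma> (Box \<gamma>)) \<beta> \<in> GL}"
  have C: "GL.filter ?C"
    unfolding GL.filter_def
  proof (intro conjI allI impI)
    have "Imp Top (Box Top) \<in> GL"
      by (rule GL_taut_mp[OF GL_nec[of Top]]) (auto intro: GL_taut)
    then have "Box Top \<in> x" using GL.prime_up[OF x] GL.prime_top[OF x] by blast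
    then show "Top \<in> ?C" by (blast intro: GL.top)
  next
    fix \<alpha> \<beta> assume "\<alpha> \<in> ?C" "Imp \<alpha> \<beta> \<in> GL"
    then show "\<beta> \<in> ?C" using GL_trans by blast
  next
    fix \<alpha> \<beta> assume "\<alpha> \<in> ?C" "\<beta> \<in> ?C"
    then obtain \<gamma> \<delta> where *: "Box \<gamma> \<in> x" "Imp (And \<gamma> (Box \<gamma>)) \<alpha> \<in> GL"
      "Box \<delta> \<in> x" "Imp (And \<delta> (Box \<delta>)) \<beta> \<in> GL" by blast
    let ?g = "And \<gamma> \<delta>"
    have "Box ?g \<in> x"
      using * GL.prime_conj_iff[OF x] GL.prime_up[OF x _ GL_Box_And] by blast
    moreover have "Imp (And ?g (Box ?g)) \<alpha> \<in> GL"
      by (rule GL_trans[OF GL.conj_mono[OF GL.conj1 GL_Box_mono[OF GL.conj1]] *(2)])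
    moreover have "Imp (And ?g (Box ?g)) \<beta> \<in> GL"
      by (rule GL_trans[OF GL.conj_mono[OF GL.conj2 GL_Box_mono[OF GL.conj2]] *(4)])
    ultimately show "And \<alpha> \<beta> \<in> ?C" using GL.conjI by blast
  qed
  let ?F = "{\<chi>. \<exists>\<beta>\<in>?C. Imp (And \<beta> (Box \<psi>)) \<chi> \<in> GL}"
  have "False" if F: "\<chi> \<in> ?F" and I: "Imp \<chi> \<psi> \<in> GL" for \<chi>
  proof -
    from F obtain \<beta> \<gamma> where *: "Box \<gamma> \<in> x" "Imp (And \<gamma> (Box \<gamma>)) \<beta> \<in> GL"
      "Imp (And \<beta> (Box \<psi>)) \<chi> \<in> GL" by blast
    have "Imp \<beta> (Imp (Box \<psi>) \<psi>) \<in> GL" by (rule GL_taut_mp2[OF *(3) I]) auto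
    with *(2) have "Imp (And \<gamma> (Box \<gamma>)) (Imp (Box \<psi>) \<psi>) \<in> GL" by (rule GL_trans)
    then have "Imp (Box \<gamma>) (Box \<psi>) \<in> GL"
      using GL_4 GL_Box_mono GL_Loeb_inst GL_trans by meson
    then show False using GL.prime_up[OF x *(1)] psi by blast
  qed
  then have "?F \<inter> {\<chi>. Imp \<chi> \<psi> \<in> GL} = {}" by blast
  then obtain y where y: "GL.prime_filter y" "?F \<subseteq> y" "y \<inter> {\<chi>. Imp \<chi> \<psi> \<in> GL} = {}"
    using GL.prime_filter_separation[OF GL.filter_extend[OF C] GL.principal_ideal] by blast
  have C_sub: "?C \<subseteq> ?F" by (blast intro: GL.conj1)
  show thesis
  proof (rule that[OF y(1)])
    have "\<chi> \<in> ?C \<and> Box \<chi> \<in> ?C" if "Box \<chi> \<in> x" for \<chi>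
      using that GL.conj1 GL.conj2 by blast
    then show "\<forall>\<chi>. Box \<chi> \<in> x \<longrightarrow> \<chi> \<in> y \<and> Box \<chi> \<in> y" using C_sub y(2) by blast
  next
    have "Top \<in> ?C" using C unfolding GL.filter_def by blast
    then show "Box \<psi> \<in> y" using y(2) GL.conj2 by blast
  next
    show "\<psi> \<notin> y" using y(3) GL.refl by blast
  qed
qed

primrec boxed :: "fm \<Rightarrow> fm set" where
  "boxed (Var x) = {}"
| "boxed Bot = {}"
| "boxed Top = {}"
| "boxed (Neg \<phi>) = boxed \<phi>"
| "boxed (And \<phi> \<psi>) = boxed \<phi> \<union> boxed \<psi>"
| "boxed (Or \<phi> \<psi>) = boxed \<phi> \<union> boxed \<psi>"
| "boxed (Imp \<phi> \<psi>) = boxed \<phi> \<union> boxed \<psi>"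
| "boxed (Box \<phi>) = insert \<phi> (boxed \<phi>)"

lemma finite_boxed: "finite (boxed \<phi>)"
  by (induction \<phi>) auto

text \<open>The last conjunct makes the relation respect a rank, but only for a finite set \<open>B\<close>; for that
  reason the model has to depend on the formula that is to be refuted.\<close>

definition GL_acc :: "fm set \<Rightarrow> fm set \<Rightarrow> fm set \<Rightarrow> bool" where
  "GL_acc B x y \<longleftrightarrow> GL.prime_filter x \<and> GL.prime_filter y \<and>
     (\<forall>\<chi>. Box \<chi> \<in> x \<longrightarrow> \<chi> \<in> y \<and> Box \<chi> \<in> y) \<and> (\<exists>\<psi>\<in>B. Box \<psi> \<in> y \<and> Box \<psi> \<notin> x)"

lemma GL_ranked:
  assumes "finite B"
  shows "ranked_frame (GL_acc B) (\<lambda>x. card {\<psi>\<in>B. Box \<psi> \<notin> x})"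
proof
  fix x y z assume "GL_acc B x y" "GL_acc B y z"
  then show "GL_acc B x z" unfolding GL_acc_def by blast
next
  fix x y assume "GL_acc B x y"
  then have "{\<psi>\<in>B. Box \<psi> \<notin> y} \<subset> {\<psi>\<in>B. Box \<psi> \<notin> x}" unfolding GL_acc_def by blast
  then show "card {\<psi>\<in>B. Box \<psi> \<notin> y} < card {\<psi>\<in>B. Box \<psi> \<notin> x}"
    using assms by (intro psubset_card_mono) auto
qed

lemma GL_truth_lemma:
  assumes "boxed \<phi> \<subseteq> B" and "GL.prime_filter x"
  shows "eval (GL_acc B) (\<lambda>x n. Var n \<in> x) x \<phi> \<longleftrightarrow> \<phi> \<in> x"
  using assms
proof (induction \<phi> arbitrary: x)
  case (Box \<phi>)
  have IH: "eval (GL_acc B) (\<lambda>x n. Var n \<in> x) y \<phi> \<longleftrightarrow> \<phi> \<in> y" if "GL_acc B x y" for y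
  proof -
    have "GL.prime_filter y" using that by (simp add: GL_acc_def)
    then show ?thesis using Box.IH Box.prems(1) by simp
  qed
  show ?case
  proof
    assume "Box \<phi> \<in> x"
    then show "eval (GL_acc B) (\<lambda>x n. Var n \<in> x) x (Box \<phi>)"
      using IH by (simp add: GL_acc_def)
  next
    assume ev: "eval (GL_acc B) (\<lambda>x n. Var n \<in> x) x (Box \<phi>)"
    show "Box \<phi> \<in> x"
    proof (rule ccontr)
      assume no: "Box \<phi> \<notin> x"
      obtain y where y: "GL.prime_filter y" "\<forall>\<chi>. Box \<chi> \<in> x \<longrightarrow> \<chi> \<in> y \<and> Box \<chi> \<in> y"
        "Box \<phi> \<in> y" "\<phi> \<notin> y"
        by (rule GL_successor[OF Box.prems(2) no])
      then have "GL_acc B x y" using no Box.prems by (auto simp: GL_acc_def)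
      then show False using ev IH y(4) by simp
    qed
  qed
qed (simp_all add: GL.prime_top GL.prime_bot GL.prime_conj_iff GL.prime_disj_iff
    GL_prime_Neg GL_prime_Imp)

theorem GL_complete:
  assumes valid: "\<And>R r V (w :: fm set). ranked_frame R r \<Longrightarrow> eval R V w \<phi>"
  shows "\<phi> \<in> GL"
proof (rule ccontr)
  assume no: "\<phi> \<notin> GL"
  have "False" if "Imp Top \<chi> \<in> GL" "Imp \<chi> \<phi> \<in> GL" for \<chi>
    using GL_mp[OF GL_trans[OF that]] no GL_taut[of Top] by simp
  then have "{\<chi>. Imp Top \<chi> \<in> GL} \<inter> {\<chi>. Imp \<chi> \<phi> \<in> GL} = {}" by auto
  then obtain x where x: "GL.prime_filter x" "x \<inter> {\<chi>. Imp \<chi> \<phi> \<in> GL} = {}"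
    by (rule GL.prime_filter_separation[OF GL.principal_filter GL.principal_ideal])
  have "eval (GL_acc (boxed \<phi>)) (\<lambda>x n. Var n \<in> x) x \<phi>"
    by (rule valid[OF GL_ranked[OF finite_boxed]])
  then have "\<phi> \<in> x" using GL_truth_lemma[OF subset_refl x(1)] by blast
  then show False using x(2) GL.refl by blast
qed

section \<open>Kripke completeness of the positive calculus\<close>

interpretation pos: distributive_prelattice "(\<turnstile>)" PAnd POr PTop PBot
  by standard (fact derivable.intros | rule derivable.intros; assumption)+

text \<open>Restricting the worlds to these prime filters loses no successors, because \<open>\<box>\<^sup>n\<^sup>+\<^sup>1\<bottom>\<close> at a
  world gives \<open>\<box>\<^sup>n\<bottom>\<close> at its successors.\<close>

definition shallow :: "pfm set \<Rightarrow> bool" where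
  "shallow x \<longleftrightarrow> pos.prime_filter x \<and> (\<exists>n. (PBox ^^ n) PBot \<in> x)"

text \<open>As negation is absent, the condition for \<open>\<diamond>\<close> does not follow from the one for \<open>\<box>\<close>, and a
  successor is bounded from below and from above.\<close>

definition pos_acc :: "pfm set \<Rightarrow> pfm set \<Rightarrow> bool" where
  "pos_acc x y \<longleftrightarrow> shallow x \<and> pos.prime_filter y \<and>
     (\<forall>\<chi>. PBox \<chi> \<in> x \<longrightarrow> \<chi> \<in> y) \<and> (\<forall>\<chi>\<in>y. PDia \<chi> \<in> x)"

lemma shallow_prime: "shallow x \<Longrightarrow> pos.prime_filter x"
  by (simp add: shallow_def)

lemma pos_acc_Box_Bot:
  assumes "pos_acc x y" "(PBox ^^ n) PBot \<in> x"
  obtains m where "n = Suc m" "(PBox ^^ m) PBot \<in> y"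
  using assms pos.prime_bot by (cases n) (auto simp: pos_acc_def shallow_def)

lemma pos_acc_shallow: "pos_acc x y \<Longrightarrow> shallow y"
  by (metis pos_acc_Box_Bot pos_acc_def shallow_def)

lemma pos_ranked: "ranked_frame pos_acc (\<lambda>x. LEAST n. (PBox ^^ n) PBot \<in> x)"
proof
  fix x y z assume xy: "pos_acc x y" and yz: "pos_acc y z"
  have x: "pos.prime_filter x" using xy by (simp add: pos_acc_def shallow_def)
  have "\<chi> \<in> z" if "PBox \<chi> \<in> x" for \<chi>
    using that pos.prime_up[OF x that ax_Box_trans] xy yz by (auto simp: pos_acc_def)
  moreover have "PDia \<chi> \<in> x" if "\<chi> \<in> z" for \<chi>
    using that pos.prime_up[OF x _ ax_Dia_trans] xy yz by (auto simp: pos_acc_def)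
  ultimately show "pos_acc x z" using xy yz by (auto simp: pos_acc_def)
next
  fix x y assume xy: "pos_acc x y"
  then have "\<exists>n. (PBox ^^ n) PBot \<in> x" by (simp add: pos_acc_def shallow_def)
  then have "(PBox ^^ (LEAST n. (PBox ^^ n) PBot \<in> x)) PBot \<in> x" by (rule LeastI_ex)
  from pos_acc_Box_Bot[OF xy this] obtain m
    where "(LEAST n. (PBox ^^ n) PBot \<in> x) = Suc m" "(PBox ^^ m) PBot \<in> y" .
  then show "(LEAST n. (PBox ^^ n) PBot \<in> y) < (LEAST n. (PBox ^^ n) PBot \<in> x)"
    by (simp add: Least_le less_Suc_eq_le)
qed

lemma Box_inverse_filter:
  assumes x: "pos.prime_filter x"
  shows "pos.filter {\<chi>. PBox \<chi> \<in> x}"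
  unfolding pos.filter_def
  using pos.prime_up[OF x _ Box_mono] pos.prime_up[OF x pos.prime_top[OF x] ax_Box_top]
    pos.prime_up[OF x _ ax_Box_and] pos.prime_conj_iff[OF x] by simp

lemma Dia_inverse_ideal:
  assumes x: "pos.prime_filter x"
  shows "pos.ideal {\<chi>. PDia \<chi> \<notin> x}"
  unfolding pos.ideal_def
  using pos.prime_up[OF x _ Dia_mono] pos.prime_up[OF x _ ax_Dia_bot] pos.prime_bot[OF x]
    pos.prime_up[OF x _ ax_Dia_or] pos.prime_disj_iff[OF x] by simp blast

text \<open>Separate \<open>\<box>\<^sup>-\<^sup>1x\<close> from the ideal generated by \<open>\<phi>\<close> and the complement of \<open>\<diamond>\<^sup>-\<^sup>1x\<close>. They
  are disjoint by the axiom \<open>\<box>(\<phi> \<or> \<delta>) \<turnstile> \<box>\<phi> \<or> \<diamond>\<delta>\<close>.\<close>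

lemma pos_successor_Box:
  assumes x: "shallow x" and phi: "PBox \<phi> \<notin> x"
  obtains y where "pos_acc x y" "\<phi> \<notin> y"
proof -
  note px = shallow_prime[OF x]
  let ?I = "{\<chi>. \<exists>\<delta>. PDia \<delta> \<notin> x \<and> \<chi> \<turnstile> POr \<phi> \<delta>}"
  have Dia_ideal: "PDia PBot \<notin> x" "\<And>\<alpha> \<beta>. PDia \<alpha> \<notin> x \<Longrightarrow> PDia \<beta> \<notin> x \<Longrightarrow> PDia (POr \<alpha> \<beta>) \<notin> x"
    using Dia_inverse_ideal[OF px] unfolding pos.ideal_def by blast+
  have I: "pos.ideal ?I"
    unfolding pos.ideal_def
  proof (intro conjI allI impI)
    show "PBot \<in> ?I" using Dia_ideal(1) ax_bot by blast
  next
    fix \<alpha> \<beta> assume "\<beta> \<in> ?I" "\<alpha> \<turnstile> \<beta>"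
    then show "\<alpha> \<in> ?I" by (auto elim: derivable.cut)
  next
    fix \<alpha> \<beta> assume "\<alpha> \<in> ?I" "\<beta> \<in> ?I"
    then obtain \<gamma> \<delta> where *: "PDia \<gamma> \<notin> x" "\<alpha> \<turnstile> POr \<phi> \<gamma>" "PDia \<delta> \<notin> x" "\<beta> \<turnstile> POr \<phi> \<delta>" by blast
    have "POr \<alpha> \<beta> \<turnstile> POr \<phi> (POr \<gamma> \<delta>)"
      by (intro or_left derivable.cut[OF *(2)] derivable.cut[OF *(4)] pos.disj_mono
          ax_refl ax_or1 ax_or2)
    then show "POr \<alpha> \<beta> \<in> ?I" using Dia_ideal(2) * by blast
  qed
  have "False" if "PBox \<chi> \<in> x" "PDia \<delta> \<notin> x" "\<chi> \<turnstile> POr \<phi> \<delta>" for \<chi> \<delta>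
  proof -
    have "POr (PBox \<phi>) (PDia \<delta>) \<in> x"
      using pos.prime_up[OF px that(1) derivable.cut[OF Box_mono[OF that(3)] ax_Box_or]] .
    then show False using pos.prime_disj_iff[OF px] phi that by blast
  qed
  then have "{\<chi>. PBox \<chi> \<in> x} \<inter> ?I = {}" by blast
  then obtain y where y: "pos.prime_filter y" "{\<chi>. PBox \<chi> \<in> x} \<subseteq> y" "y \<inter> ?I = {}"
    by (rule pos.prime_filter_separation[OF Box_inverse_filter[OF px] I])
  have "\<phi> \<in> ?I" using Dia_ideal(1) ax_or1 by blast
  moreover have "{\<chi>. PDia \<chi> \<notin> x} \<subseteq> ?I" using ax_or2 by blast
  ultimately show thesis using that[of y] x y by (auto simp: pos_acc_def)
qed

text \<open>Separate the filter generated by \<open>\<phi>\<close> and \<open>\<box>\<^sup>-\<^sup>1x\<close> from the complement of \<open>\<diamond>\<^sup>-\<^sup>1x\<close>. They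
  are disjoint by the axiom \<open>\<diamond>\<phi> \<and> \<box>\<beta> \<turnstile> \<diamond>(\<phi> \<and> \<beta>)\<close>.\<close>

lemma pos_successor_Dia:
  assumes x: "shallow x" and phi: "PDia \<phi> \<in> x"
  obtains y where "pos_acc x y" "\<phi> \<in> y"
proof -
  note px = shallow_prime[OF x]
  let ?F = "{\<chi>. \<exists>\<beta>\<in>{\<beta>. PBox \<beta> \<in> x}. PAnd \<beta> \<phi> \<turnstile> \<chi>}"
  have "PDia \<chi> \<in> x" if "PBox \<beta> \<in> x" "PAnd \<beta> \<phi> \<turnstile> \<chi>" for \<beta> \<chi>
  proof -
    have "PDia (PAnd \<phi> \<beta>) \<in> x"
      using phi that pos.prime_conj_iff[OF px] pos.prime_up[OF px _ ax_Dia_Box_and] by blast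
    moreover have "PAnd \<phi> \<beta> \<turnstile> \<chi>"
      by (rule derivable.cut[OF and_right[OF ax_and2 ax_and1] that(2)])
    ultimately show ?thesis using pos.prime_up[OF px _ Dia_mono] by blast
  qed
  then have "?F \<inter> {\<chi>. PDia \<chi> \<notin> x} = {}" by blast
  then obtain y where y: "pos.prime_filter y" "?F \<subseteq> y" "y \<inter> {\<chi>. PDia \<chi> \<notin> x} = {}"
    by (rule pos.prime_filter_separation[OF pos.filter_extend[OF Box_inverse_filter[OF px]]
          Dia_inverse_ideal[OF px]])
  have "{\<beta>. PBox \<beta> \<in> x} \<subseteq> ?F" using ax_and1 by blast
  moreover have "PBox PTop \<in> x"
    using Box_inverse_filter[OF px] unfolding pos.filter_def by blast
  then have "\<phi> \<in> ?F" using ax_and2 by blast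
  ultimately show thesis using that[of y] x y by (auto simp: pos_acc_def)
qed

lemma pos_truth_lemma:
  "shallow x \<Longrightarrow> eval pos_acc (\<lambda>x n. PVar n \<in> x) x (fm_of \<phi>) \<longleftrightarrow> \<phi> \<in> x"
proof (induction \<phi> arbitrary: x)
  case (PDia \<phi>)
  then have "eval pos_acc (\<lambda>x n. PVar n \<in> x) x (fm_of (PDia \<phi>)) \<longleftrightarrow> (\<exists>y. pos_acc x y \<and> \<phi> \<in> y)"
    using pos_acc_shallow by auto
  also have "\<dots> \<longleftrightarrow> PDia \<phi> \<in> x"
    using pos_successor_Dia[OF PDia.prems] by (metis pos_acc_def)
  finally show ?case .
next
  case (PBox \<phi>)
  then have "eval pos_acc (\<lambda>x n. PVar n \<in> x) x (fm_of (PBox \<phi>)) \<longleftrightarrow> (\<forall>y. pos_acc x y \<longrightarrow> \<phi> \<in> y)"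
    using pos_acc_shallow by auto
  also have "\<dots> \<longleftrightarrow> PBox \<phi> \<in> x"
    using pos_successor_Box[OF PBox.prems] by (metis pos_acc_def)
  finally show ?case .
qed (auto dest: shallow_prime simp: pos.prime_top pos.prime_bot pos.prime_conj_iff pos.prime_disj_iff)

theorem derivable_complete:
  assumes valid: "\<And>R r V (w :: pfm set). ranked_frame R r \<Longrightarrow>
    eval R V w (fm_of \<phi>) \<Longrightarrow> eval R V w (fm_of \<psi>)"
  shows "\<phi> \<turnstile> \<psi>"
proof (rule GLD_Box, rule ccontr)
  fix n
  let ?\<phi> = "PAnd \<phi> ((PBox ^^ n) PBot)"
  assume "\<not> ?\<phi> \<turnstile> \<psi>"
  then have "{\<chi>. ?\<phi> \<turnstile> \<chi>} \<inter> {\<chi>. \<chi> \<turnstile> \<psi>} = {}" by (auto dest: derivable.cut)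
  then obtain x where x: "pos.prime_filter x" "{\<chi>. ?\<phi> \<turnstile> \<chi>} \<subseteq> x" "x \<inter> {\<chi>. \<chi> \<turnstile> \<psi>} = {}"
    by (rule pos.prime_filter_separation[OF pos.principal_filter pos.principal_ideal])
  have "?\<phi> \<in> x" "\<psi> \<notin> x" using x ax_refl by blast+
  then have "\<phi> \<in> x" and shallow: "shallow x"
    using pos.prime_conj_iff[OF x(1)] x(1) by (auto simp: shallow_def)
  then have "eval pos_acc (\<lambda>x n. PVar n \<in> x) x (fm_of \<psi>)"
    using valid[OF pos_ranked] pos_truth_lemma[OF shallow] by blast
  then show False using pos_truth_lemma[OF shallow] \<open>\<psi> \<notin> x\<close> by blast
qed

section \<open>The positive fragment of GL\<close>

theorem theorem5p8:
  fixes \<phi> \<psi> :: pfm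
  shows "Imp (fm_of \<phi>) (fm_of \<psi>) \<in> GL \<longleftrightarrow> \<phi> \<turnstile> \<psi>"
proof
  assume "Imp (fm_of \<phi>) (fm_of \<psi>) \<in> GL"
  then show "\<phi> \<turnstile> \<psi>"
    by (intro derivable_complete) (use ranked_frame.GL_sound in fastforce)
next
  assume "\<phi> \<turnstile> \<psi>"
  then show "Imp (fm_of \<phi>) (fm_of \<psi>) \<in> GL"
    by (intro GL_complete) (simp add: ranked_frame.derivable_sound)
qed

end
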